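(* Let $(X,\mathcal{A},\lambda)$ be a $\sigma$-finite measure space and $T:X\to X$ a null-preserving map. Then the following are equivalent: (i) the system $(X,\mathcal{A},\lambda,T)$ is conservative; (ii) for every $A\in\mathcal{A}$ we have $A\overset{.}{\subseteq}\bigcup_{n\ge1}\hat{T}^nA$; (iii) for every $A\in\mathcal{A}$ we have $A\overset{.}{\subseteq}\limsup_{n\to\infty}\hat{T}^nA:=\bigcap_{m\ge1}\bigcup_{n\ge m}\hat{T}^nA$; (iv) for every $A\in\mathcal{A}$ with $\hat{T}A\overset{.}{\subseteq}A$ we have $\hat{T}A^c\overset{.}{\subseteq}A^c$. In this case, the system is also nonsingular.
   Context: For $A,B\in\mathcal{A}$ write $A\overset{.}{\subseteq}B$ if $\lambda(A\setminus B)=0$ and $A\overset{.}{=}B$ if $\lambda(A\triangle B)=0$. A measurable map $T:X\to X$ is null-preserving if $\lambda(A)=0$ implies $\lambda(T^{-1}A)=0$ for $A\in\mathcal{A}$. An essential image of $A\in\mathcal{A}$ under $T$ is a set $A'\in\mathcal{A}$ such that $T^{-1}A'\overset{.}{\supseteq}A$ and such that every $B'\in\mathcal{A}$ with $T^{-1}B'\overset{.}{\supseteq}A$ satisfies $B'\overset{.}{\supseteq}A'$. In the present ($\sigma$-finite, null-preserving) setting every $A\in\mathcal{A}$ has essential images and they form exactly one equivalence class under $\overset{.}{=}$; $\hat{T}A$ denotes an arbitrary fixed essential image of $A$, and $\hat{T}^n$ is the $n$-fold iterate. A set $W\in\mathcal{A}$ is wandering if $W\cap T^{-n}W\overset{.}{=}\varnothing$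 for all $n\ge1$. The system is conservative if $\lambda(W)=0$ for each wandering set $W$. It is nonsingular if $\lambda\circ T^{-1}$ and $\lambda$ are mutually absolutely continuous. *)

theory Defs
  imports "HOL-Analysis.Analysis"
begin

definition ae_subset :: "'a measure \<Rightarrow> 'a set \<Rightarrow> 'a set \<Rightarrow> bool" where
  "ae_subset M A B \<longleftrightarrow> emeasure M (A - B) = 0"

definition ae_eq :: "'a measure \<Rightarrow> 'a set \<Rightarrow> 'a set \<Rightarrow> bool" where
  "ae_eq M A B \<longleftrightarrow> emeasure M ((A - B) \<union> (B - A)) = 0"

definition null_preserving :: "'a measure \<Rightarrow> ('a \<Rightarrow> 'a) \<Rightarrow> bool" where
  "null_preserving M T \<longleftrightarrow>
     T \<in> measurable M M \<and>
     (\<forall>A\<in>sets M. emeasure M A = 0 \<longrightarrow> emeasure M (T -` A \<inter> space M) = 0)"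

definition essential_image :: "'a measure \<Rightarrow> ('a \<Rightarrow> 'a) \<Rightarrow> 'a set \<Rightarrow> 'a set \<Rightarrow> bool" where
  "essential_image M T A A' \<longleftrightarrow>
     A' \<in> sets M \<and>
     ae_subset M A (T -` A' \<inter> space M) \<and>
     (\<forall>B'\<in>sets M. ae_subset M A (T -` B' \<inter> space M) \<longrightarrow> ae_subset M A' B')"

definition wandering :: "'a measure \<Rightarrow> ('a \<Rightarrow> 'a) \<Rightarrow> 'a set \<Rightarrow> bool" where
  "wandering M T W \<longleftrightarrow>
     W \<in> sets M \<and> (\<forall>n\<ge>1. ae_eq M (W \<inter> ((T ^^ n) -` W \<inter> space M)) {})"

definition conservative :: "'a measure \<Rightarrow> ('a \<Rightarrow> 'a) \<Rightarrow> bool" where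
  "conservative M T \<longleftrightarrow> (\<forall>W. wandering M T W \<longrightarrow> emeasure M W = 0)"

definition nonsingular :: "'a measure \<Rightarrow> ('a \<Rightarrow> 'a) \<Rightarrow> bool" where
  "nonsingular M T \<longleftrightarrow>
     absolutely_continuous M (distr M M T) \<and> absolutely_continuous (distr M M T) M"

text \<open>A selection of essential images, one for each measurable set. Existence of such selections
  and uniqueness of essential images up to null sets are proved below.\<close>

definition essential_image_map ::
    "'a measure \<Rightarrow> ('a \<Rightarrow> 'a) \<Rightarrow> ('a set \<Rightarrow> 'a set) \<Rightarrow> bool" where
  "essential_image_map M T That \<longleftrightarrow> (\<forall>A\<in>sets M. essential_image M T A (That A))"

lemma ae_subset_iff_AE:
  assumes "A \<in> sets M" and "B \<in> sets M"
  shows "ae_subset M A B \<longleftrightarrow> (AE x in M. x \<in> A \<longrightarrow> x \<in> B)"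
proof -
  have "ae_subset M A B \<longleftrightarrow> (AE x in M. x \<notin> A - B)"
    using assms by (subst AE_iff_null_sets[symmetric]) (auto simp: ae_subset_def null_sets_def)
  then show ?thesis by simp
qed

lemma essential_image_exists:
  assumes "sigma_finite_measure M" and "null_preserving M T" and A: "A \<in> sets M"
  shows "\<exists>A'. essential_image M T A A'"
proof -
  interpret sigma_finite_measure M by fact
  have T [measurable]: "T \<in> measurable M M"
    and null: "\<And>B. B \<in> sets M \<Longrightarrow> emeasure M B = 0 \<Longrightarrow> emeasure M (T -` B \<inter> space M) = 0"
    using assms(2) by (auto simp: null_preserving_def)
  note A [measurable]
  define N where "N = distr (density M (indicator A)) M T"
  have N: "emeasure N B = emeasure M (A \<inter> (T -` B \<inter> space M))" if [measurable]: "B \<in> sets M" for B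
    by (simp add: N_def emeasure_distr emeasure_density nn_integral_indicator
          flip: indicator_inter_arith)
  have "absolutely_continuous M N"
    unfolding absolutely_continuous_def
  proof
    fix B assume "B \<in> null_sets M"
    then have B [measurable]: "B \<in> sets M" and "emeasure M B = 0" by auto
    then have "emeasure M (A \<inter> (T -` B \<inter> space M)) \<le> 0"
      using null[of B] by (metis emeasure_mono inf_le2 T B measurable_sets)
    then show "B \<in> null_sets N"
      using N[OF B] by (auto simp: N_def)
  qed
  then obtain f where f [measurable]: "f \<in> borel_measurable M" and fN: "density M f = N"
    using Radon_Nikodym[of N] by (auto simp: N_def)
  have ae_iff: "ae_subset M A (T -` B \<inter> space M) \<longleftrightarrow> (AE x in M. x \<notin> B \<longrightarrow> f x = 0)"
    if [measurable]: "B \<in> sets M" for B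
  proof -
    have "A - (T -` B \<inter> space M) = A \<inter> (T -` (space M - B) \<inter> space M)"
      using sets.sets_into_space[OF A] measurable_space[OF T] by auto
    then have "ae_subset M A (T -` B \<inter> space M) \<longleftrightarrow> emeasure (density M f) (space M - B) = 0"
      using N[of "space M - B"] fN by (simp add: ae_subset_def)
    also have "\<dots> \<longleftrightarrow> (AE x in M. f x * indicator (space M - B) x = 0)"
      by (subst emeasure_density) (auto simp: nn_integral_0_iff_AE)
    also have "\<dots> \<longleftrightarrow> (AE x in M. x \<notin> B \<longrightarrow> f x = 0)"
      by (rule AE_cong) (auto simp: indicator_def)
    finally show ?thesis .
  qed
  define A' where "A' = {x \<in> space M. f x \<noteq> 0}"
  have A' [measurable]: "A' \<in> sets M" by (simp add: A'_def)
  have "ae_subset M A' B" if [measurable]: "B \<in> sets M" and "ae_subset M A (T -` B \<inter> space M)" for B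
  proof -
    have "AE x in M. x \<notin> B \<longrightarrow> f x = 0"
      using that by (simp add: ae_iff)
    then have "AE x in M. x \<in> A' \<longrightarrow> x \<in> B"
      by eventually_elim (auto simp: A'_def)
    then show ?thesis
      by (simp add: ae_subset_iff_AE)
  qed
  moreover have "ae_subset M A (T -` A' \<inter> space M)"
    by (subst ae_iff) (auto simp: A'_def)
  ultimately show ?thesis
    using A' unfolding essential_image_def by blast
qed

lemma ae_eq_iff_AE:
  assumes "A \<in> sets M" and "B \<in> sets M"
  shows "ae_eq M A B \<longleftrightarrow> (AE x in M. x \<in> A \<longleftrightarrow> x \<in> B)"
proof -
  have "ae_eq M A B \<longleftrightarrow> (AE x in M. x \<notin> (A - B) \<union> (B - A))"
    using assms by (subst AE_iff_null_sets[symmetric]) (auto simp: ae_eq_def null_sets_def)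
  also have "\<dots> \<longleftrightarrow> (AE x in M. x \<in> A \<longleftrightarrow> x \<in> B)"
    by (rule AE_cong) auto
  finally show ?thesis .
qed

lemma essential_image_unique:
  assumes "null_preserving M T" and A: "A \<in> sets M" and A': "essential_image M T A A'"
  shows "essential_image M T A B \<longleftrightarrow> B \<in> sets M \<and> ae_eq M A' B"
proof
  assume B: "essential_image M T A B"
  then have sets: "A' \<in> sets M" "B \<in> sets M"
    using A' by (auto simp: essential_image_def)
  have "ae_subset M A' B" "ae_subset M B A'"
    using A' B by (auto simp: essential_image_def)
  then show "B \<in> sets M \<and> ae_eq M A' B"
    using sets by (auto simp: ae_subset_iff_AE ae_eq_iff_AE)
next
  assume B: "B \<in> sets M \<and> ae_eq M A' B"
  have T: "T \<in> measurable M M"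
    and null: "\<And>C. C \<in> sets M \<Longrightarrow> emeasure M C = 0 \<Longrightarrow> emeasure M (T -` C \<inter> space M) = 0"
    using assms(1) by (auto simp: null_preserving_def)
  have sets: "A' \<in> sets M" "B \<in> sets M"
    using A' B by (auto simp: essential_image_def)
  have pre: "T -` C \<inter> space M \<in> sets M" if "C \<in> sets M" for C
    using T that by (rule measurable_sets)
  have eq: "AE x in M. x \<in> A' \<longleftrightarrow> x \<in> B"
    using B sets by (simp add: ae_eq_iff_AE)
  have "T -` (A' - B \<union> (B - A')) \<inter> space M \<in> null_sets M"
    using B sets null[of "A' - B \<union> (B - A')"] pre[of "A' - B \<union> (B - A')"]
    by (auto simp: ae_eq_def null_sets_def)
  then have eqT: "AE x in M. x \<notin> T -` (A' - B \<union> (B - A')) \<inter> space M"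
    by (rule AE_not_in)
  have "AE x in M. x \<in> A \<longrightarrow> x \<in> T -` A' \<inter> space M"
    using A' A sets pre by (auto simp: essential_image_def ae_subset_iff_AE)
  with eqT have "AE x in M. x \<in> A \<longrightarrow> x \<in> T -` B \<inter> space M"
    by eventually_elim auto
  moreover have "ae_subset M B C" if C: "C \<in> sets M" and "ae_subset M A (T -` C \<inter> space M)" for C
  proof -
    have "AE x in M. x \<in> A' \<longrightarrow> x \<in> C"
      using A' C that(2) sets by (auto simp: essential_image_def simp flip: ae_subset_iff_AE)
    with eq have "AE x in M. x \<in> B \<longrightarrow> x \<in> C"
      by eventually_elim auto
    then show ?thesis
      using sets C by (simp add: ae_subset_iff_AE)
  qed
  ultimately show "essential_image M T A B"
    using A sets pre by (auto simp: essential_image_def ae_subset_iff_AE[of A])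
qed

lemma essential_image_map_exists:
  assumes "sigma_finite_measure M" and "null_preserving M T"
  shows "\<exists>That. essential_image_map M T That"
  unfolding essential_image_map_def using essential_image_exists[OF assms] by (intro bchoice) blast

end

theory Submission
  imports Defs
begin

text \<open>The essential image is left adjoint to the preimage: \<open>That A\<close> is almost contained in \<open>B\<close> iff
  \<open>A\<close> is almost contained in the preimage of \<open>B\<close>. Passing to iterates and complements, \<open>That\<^sup>n A\<close> is
  almost disjoint from \<open>B\<close> iff \<open>A\<close> is almost disjoint from the \<open>n\<close>-th preimage of \<open>B\<close>; so \<open>W\<close> is
  wandering iff it is almost disjoint from all its images \<open>That\<^sup>n W\<close>, \<open>n \<ge> 1\<close>. Hence the part of \<open>A\<close>
  outside all its images is wandering, and a wandering set violates the recurrence property (ii) or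
  the invariance property (iv) unless it is null.\<close>

section \<open>Inclusion modulo null sets\<close>

lemma ae_subset_refl: "ae_subset M A A"
  by (simp add: ae_subset_def)

lemma ae_subset_mono:
  assumes "A \<in> sets M" "B \<in> sets M" "A \<subseteq> B"
  shows "ae_subset M A B"
  using assms by (auto simp: ae_subset_iff_AE)

lemma ae_subset_trans:
  assumes "A \<in> sets M" "B \<in> sets M" "C \<in> sets M" "ae_subset M A B" "ae_subset M B C"
  shows "ae_subset M A C"
  using assms by (auto simp: ae_subset_iff_AE)

lemma ae_subset_UN:
  assumes "countable I" "\<And>i. i \<in> I \<Longrightarrow> A i \<in> sets M" "B \<in> sets M"
    and "\<And>i. i \<in> I \<Longrightarrow> ae_subset M (A i) B"
  shows "ae_subset M (\<Union>i\<in>I. A i) B"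
proof -
  have "AE x in M. \<forall>i\<in>I. x \<in> A i \<longrightarrow> x \<in> B"
    using assms by (subst AE_ball_countable) (auto simp flip: ae_subset_iff_AE)
  moreover have "(\<Union>i\<in>I. A i) \<in> sets M"
    using assms by (intro sets.countable_UN'') auto
  ultimately show ?thesis
    using assms(3) by (simp add: ae_subset_iff_AE)
qed

lemma ae_subset_INT:
  assumes "countable I" "I \<noteq> {}" "\<And>i. i \<in> I \<Longrightarrow> B i \<in> sets M" "A \<in> sets M"
    and "\<And>i. i \<in> I \<Longrightarrow> ae_subset M A (B i)"
  shows "ae_subset M A (\<Inter>i\<in>I. B i)"
proof -
  have "AE x in M. \<forall>i\<in>I. x \<in> A \<longrightarrow> x \<in> B i"
    using assms by (subst AE_ball_countable) (auto simp flip: ae_subset_iff_AE)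
  moreover have "(\<Inter>i\<in>I. B i) \<in> sets M"
    using assms by (intro sets.countable_INT') auto
  ultimately show ?thesis
    using assms(4) by (auto simp: ae_subset_iff_AE)
qed

text \<open>The difference of the two preimages is the preimage of the null set
  \<open>A - B\<close>, which \<open>T\<close> keeps null.\<close>

lemma null_preserving_vimage_mono:
  assumes "null_preserving M T" and sets: "A \<in> sets M" "B \<in> sets M" and sub: "ae_subset M A B"
  shows "ae_subset M (T -` A \<inter> space M) (T -` B \<inter> space M)"
proof -
  have "(T -` A \<inter> space M) - (T -` B \<inter> space M) = T -` (A - B) \<inter> space M"
    by auto
  then show ?thesis
    using assms by (auto simp: null_preserving_def ae_subset_def)
qed

section \<open>Essential images as left adjoint to preimages\<close>

locale essential_image_system =
  fixes M :: "'a measure" and T :: "'a \<Rightarrow> 'a" and That :: "'a set \<Rightarrow> 'a set"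
  assumes null_preserving: "null_preserving M T"
    and image_map: "essential_image_map M T That"
begin

lemma measurable_T: "T \<in> measurable M M"
  using null_preserving by (simp add: null_preserving_def)

lemma measurable_funpow_T: "T ^^ n \<in> measurable M M"
  using measurable_T by (rule measurable_compose_n)

lemma sets_vimage: "A \<in> sets M \<Longrightarrow> T -` A \<inter> space M \<in> sets M"
  by (rule measurable_sets[OF measurable_T])

lemma sets_vimage_funpow: "A \<in> sets M \<Longrightarrow> (T ^^ n) -` A \<inter> space M \<in> sets M"
  by (rule measurable_sets[OF measurable_funpow_T])

lemma vimage_funpow_Suc:
  "(T ^^ Suc n) -` A \<inter> space M = T -` ((T ^^ n) -` A \<inter> space M) \<inter> space M"
  using measurable_space[OF measurable_T] by (auto simp: funpow_swap1)

lemma sets_That: "A \<in> sets M \<Longrightarrow> That A \<in> sets M"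
  using image_map by (simp add: essential_image_map_def essential_image_def)

lemma sets_funpow_That: "A \<in> sets M \<Longrightarrow> (That ^^ n) A \<in> sets M"
  by (induction n) (auto intro: sets_That)

lemma sets_UN_funpow_That: "A \<in> sets M \<Longrightarrow> (\<Union>n\<in>I. (That ^^ n) A) \<in> sets M"
  by (intro sets.countable_UN'') (auto intro: sets_funpow_That)

text \<open>From right to left this is minimality of the essential image. From left to right, pull
  the inclusion back along \<open>T\<close> and precede it by the inclusion of \<open>A\<close> in
  the preimage of \<open>That A\<close>.\<close>

lemma That_ae_subset_iff:
  assumes A: "A \<in> sets M" and B: "B \<in> sets M"
  shows "ae_subset M (That A) B \<longleftrightarrow> ae_subset M A (T -` B \<inter> space M)"
proof
  have ess: "essential_image M T A (That A)"
    using image_map A by (simp add: essential_image_map_def)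
  show "ae_subset M (That A) B" if "ae_subset M A (T -` B \<inter> space M)"
    using ess that B by (auto simp: essential_image_def)
  assume "ae_subset M (That A) B"
  then have "ae_subset M (T -` That A \<inter> space M) (T -` B \<inter> space M)"
    by (rule null_preserving_vimage_mono[OF null_preserving sets_That[OF A] B])
  moreover have "ae_subset M A (T -` That A \<inter> space M)"
    using ess by (simp add: essential_image_def)
  ultimately show "ae_subset M A (T -` B \<inter> space M)"
    using ae_subset_trans[OF A sets_vimage[OF sets_That[OF A]] sets_vimage[OF B]] by blast
qed

lemma ae_subset_vimage_That:
  assumes "A \<in> sets M"
  shows "ae_subset M A (T -` That A \<inter> space M)"
  using That_ae_subset_iff[OF assms sets_That[OF assms]] ae_subset_refl by blast

text \<open>\<open>A\<close> lies almost in \<open>B\<close>, hence almost in the preimage of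
  \<open>That B\<close>; the adjunction turns this into the claim.\<close>

lemma That_mono:
  assumes "A \<in> sets M" "B \<in> sets M" "ae_subset M A B"
  shows "ae_subset M (That A) (That B)"
  using ae_subset_trans[OF assms(1,2) sets_vimage[OF sets_That[OF assms(2)]] assms(3)]
    ae_subset_vimage_That[OF assms(2)] That_ae_subset_iff[OF assms(1) sets_That[OF assms(2)]]
  by simp

text \<open>Adjunctions compose. The induction keeps \<open>A\<close> arbitrary, since the
  hypothesis is applied to \<open>That A\<close> with the innermost image split off.\<close>

lemma funpow_That_ae_subset_iff:
  assumes "A \<in> sets M" "B \<in> sets M"
  shows "ae_subset M ((That ^^ n) A) B \<longleftrightarrow> ae_subset M A ((T ^^ n) -` B \<inter> space M)"
  using assms
proof (induction n arbitrary: A)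
  case 0
  then show ?case
    using sets.sets_into_space[OF 0(2)] by (simp add: Int_absorb2)
next
  case (Suc n)
  have "ae_subset M ((That ^^ Suc n) A) B \<longleftrightarrow> ae_subset M (That A) ((T ^^ n) -` B \<inter> space M)"
    using Suc.IH[OF sets_That[OF Suc.prems(1)] Suc.prems(2)] by (simp add: funpow_swap1)
  also have "\<dots> \<longleftrightarrow> ae_subset M A ((T ^^ Suc n) -` B \<inter> space M)"
    unfolding vimage_funpow_Suc
    by (rule That_ae_subset_iff[OF Suc.prems(1) sets_vimage_funpow[OF Suc.prems(2)]])
  finally show ?case .
qed

text \<open>Being almost disjoint from \<open>B\<close> is being almost contained in its complement,
  and preimages commute with complements.\<close>

lemma funpow_That_disjoint_iff:
  assumes A: "A \<in> sets M" and B: "B \<in> sets M"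
  shows "emeasure M ((That ^^ n) A \<inter> B) = 0 \<longleftrightarrow>
         emeasure M (A \<inter> ((T ^^ n) -` B \<inter> space M)) = 0"
proof -
  have "(That ^^ n) A \<inter> B = (That ^^ n) A - (space M - B)"
    using sets.sets_into_space[OF sets_funpow_That[OF A]] by auto
  moreover have "A \<inter> ((T ^^ n) -` B \<inter> space M) = A - ((T ^^ n) -` (space M - B) \<inter> space M)"
    using sets.sets_into_space[OF A] measurable_space[OF measurable_funpow_T] by auto
  ultimately show ?thesis
    using funpow_That_ae_subset_iff[of A "space M - B" n] assms by (simp add: ae_subset_def)
qed

section \<open>Wandering sets and recurrence\<close>

lemma wandering_iff:
  assumes "W \<in> sets M"
  shows "wandering M T W \<longleftrightarrow> (\<forall>n\<ge>1. emeasure M ((That ^^ n) W \<inter> W) = 0)"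
  using assms by (simp add: wandering_def ae_eq_def funpow_That_disjoint_iff)

lemma wandering_disjoint_images:
  assumes W: "W \<in> sets M" and wand: "wandering M T W"
  shows "emeasure M (W \<inter> (\<Union>n\<in>{1..}. (That ^^ n) W)) = 0"
proof -
  have "(\<Union>n\<in>{1..}. (That ^^ n) W \<inter> W) \<in> null_sets M"
    using wand W sets_funpow_That[OF W] by (intro null_sets_UN') (auto simp: wandering_iff)
  then show ?thesis
    by (simp add: Int_commute Int_UN_distrib2 null_setsD1)
qed

lemma conservative_iff_ae_subset_UN:
  "conservative M T \<longleftrightarrow> (\<forall>A\<in>sets M. ae_subset M A (\<Union>n\<in>{1..}. (That ^^ n) A))"
proof
  assume cons: "conservative M T"
  show "\<forall>A\<in>sets M. ae_subset M A (\<Union>n\<in>{1..}. (That ^^ n) A)"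
  proof
    fix A assume A: "A \<in> sets M"
    define W where "W = A - (\<Union>n\<in>{1..}. (That ^^ n) A)"
    have W: "W \<in> sets M"
      using A sets_UN_funpow_That[OF A] by (auto simp: W_def)
    have "emeasure M (W \<inter> ((T ^^ n) -` W \<inter> space M)) = 0" if "n \<ge> 1" for n
    proof -
      \<comment> \<open>All images of the larger set \<open>A\<close>, not only those of
        \<open>W\<close>, miss \<open>W\<close>. By duality \<open>A\<close> almost misses the
        preimages of \<open>W\<close>, and so does its subset \<open>W\<close>.\<close>
      have "(That ^^ n) A \<inter> W = {}"
        using that by (auto simp: W_def)
      then have "emeasure M (A \<inter> ((T ^^ n) -` W \<inter> space M)) = 0"
        using funpow_That_disjoint_iff[OF A W, of n] by simp
      moreover have "W \<inter> ((T ^^ n) -` W \<inter> space M) \<subseteq> A \<inter> ((T ^^ n) -` W \<inter> space M)"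
        by (auto simp: W_def)
      ultimately show ?thesis
        using A sets_vimage_funpow[OF W] by (metis emeasure_eq_0 sets.Int)
    qed
    then have "wandering M T W"
      using W by (simp add: wandering_def ae_eq_def)
    then show "ae_subset M A (\<Union>n\<in>{1..}. (That ^^ n) A)"
      using cons by (auto simp: conservative_def ae_subset_def W_def)
  qed
next
  assume rec: "\<forall>A\<in>sets M. ae_subset M A (\<Union>n\<in>{1..}. (That ^^ n) A)"
  have "emeasure M W = 0" if wand: "wandering M T W" for W
  proof -
    let ?U = "\<Union>n\<in>{1..}. (That ^^ n) W"
    have W: "W \<in> sets M"
      using wand by (simp add: wandering_def)
    \<comment> \<open>Recurrence makes the part of \<open>W\<close> outside its images null,
      wandering the part inside.\<close>
    have "emeasure M (W - ?U) = 0" "emeasure M (W \<inter> ?U) = 0"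
      using rec W wandering_disjoint_images[OF W wand] by (simp_all add: ae_subset_def)
    then have "(W - ?U) \<union> (W \<inter> ?U) \<in> null_sets M"
      using W sets_UN_funpow_That[OF W] by (intro null_sets.Un) (auto simp: null_sets_def)
    then show ?thesis
      by (simp add: Un_Diff_Int null_setsD1)
  qed
  then show "conservative M T"
    by (simp add: conservative_def)
qed

section \<open>Infinite recurrence\<close>

lemma conservative_iff_ae_subset_limsup:
  "conservative M T \<longleftrightarrow>
     (\<forall>A\<in>sets M. ae_subset M A (\<Inter>m\<in>{1..}. \<Union>n\<in>{m..}. (That ^^ n) A))"
proof
  assume "conservative M T"
  then have rec: "ae_subset M A (\<Union>n\<in>{1..}. (That ^^ n) A)" if "A \<in> sets M" for A
    using that by (simp add: conservative_iff_ae_subset_UN)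
  show "\<forall>A\<in>sets M. ae_subset M A (\<Inter>m\<in>{1..}. \<Union>n\<in>{m..}. (That ^^ n) A)"
  proof
    fix A assume A: "A \<in> sets M"
    let ?U = "\<lambda>m. \<Union>n\<in>{m..}. (That ^^ n) A"
    have U: "?U m \<in> sets M" for m
      by (rule sets_UN_funpow_That[OF A])
    \<comment> \<open>Recurrence is applied to each image of \<open>A\<close> instead of
      \<open>A\<close> itself: every set in the tail from \<open>m\<close> is almost covered by its
      own later images, which belong to the tail from \<open>Suc m\<close>.\<close>
    have U_Suc: "ae_subset M (?U m) (?U (Suc m))" for m
    proof (rule ae_subset_UN)
      fix n assume "n \<in> {m..}"
      have "(\<Union>k\<in>{1..}. (That ^^ k) ((That ^^ n) A)) = (\<Union>k\<in>{1..}. (That ^^ (k + n)) A)"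
        by (simp add: funpow_add)
      also have "\<dots> \<subseteq> ?U (Suc m)"
        using \<open>n \<in> {m..}\<close> by (intro UN_least UN_upper) auto
      finally have "ae_subset M (\<Union>k\<in>{1..}. (That ^^ k) ((That ^^ n) A)) (?U (Suc m))"
        by (intro ae_subset_mono U sets_UN_funpow_That sets_funpow_That A)
      then show "ae_subset M ((That ^^ n) A) (?U (Suc m))"
        using ae_subset_trans[OF _ _ U rec[OF sets_funpow_That[OF A]]]
          sets_UN_funpow_That sets_funpow_That A by blast
    qed (auto intro: U sets_funpow_That A)
    have "ae_subset M A (?U m)" if "m \<ge> 1" for m
      using that
    proof (induction m rule: dec_induct)
      case base
      show ?case using rec[OF A] by simp
    next
      case (step m)
      then show ?case
        using ae_subset_trans[OF A U U] U_Suc by blast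
    qed
    then show "ae_subset M A (\<Inter>m\<in>{1..}. ?U m)"
      by (intro ae_subset_INT U A) auto
  qed
next
  assume lim: "\<forall>A\<in>sets M. ae_subset M A (\<Inter>m\<in>{1..}. \<Union>n\<in>{m..}. (That ^^ n) A)"
  have "ae_subset M A (\<Union>n\<in>{1..}. (That ^^ n) A)" if A: "A \<in> sets M" for A
  proof -
    have "(\<Inter>m\<in>{1..}. \<Union>n\<in>{m..}. (That ^^ n) A) \<in> sets M"
      by (intro sets.countable_INT' sets_UN_funpow_That[OF A] image_subsetI) auto
    \<comment> \<open>The upper limit is contained in its term for \<open>m = 1\<close>.\<close>
    moreover from this have "ae_subset M (\<Inter>m\<in>{1..}. \<Union>n\<in>{m..}. (That ^^ n) A) (\<Union>n\<in>{1..}. (That ^^ n) A)"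
      by (intro ae_subset_mono sets_UN_funpow_That A INT_lower) auto
    ultimately show ?thesis
      using lim A ae_subset_trans[OF A _ sets_UN_funpow_That[OF A]] by blast
  qed
  then show "conservative M T"
    by (simp add: conservative_iff_ae_subset_UN)
qed

section \<open>Invariant sets and their complements\<close>

text \<open>After the adjunction, both sides say that one and the same set, the preimage of
  \<open>A\<close> minus \<open>A\<close>, is null. This removes the essential image of a complement
  from condition (iv).\<close>

lemma That_compl_ae_subset_iff:
  assumes A: "A \<in> sets M"
  shows "ae_subset M (That (space M - A)) (space M - A) \<longleftrightarrow> ae_subset M (T -` A \<inter> space M) A"
proof -
  have "(space M - A) - (T -` (space M - A) \<inter> space M) = (T -` A \<inter> space M) - A"
    using measurable_space[OF measurable_T] by auto
  then show ?thesis
    using A That_ae_subset_iff[of "space M - A" "space M - A"] by (simp add: ae_subset_def)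
qed

text \<open>Recurrence is used for the preimage \<open>?P\<close> of \<open>A\<close>: its first
  image lies almost in \<open>A\<close>, invariance keeps all later ones there, and together they
  almost cover \<open>?P\<close>.\<close>

lemma conservative_imp_That_compl:
  assumes cons: "conservative M T" and A: "A \<in> sets M" and inv: "ae_subset M (That A) A"
  shows "ae_subset M (That (space M - A)) (space M - A)"
proof -
  let ?P = "T -` A \<inter> space M"
  have P: "?P \<in> sets M"
    by (rule sets_vimage[OF A])
  \<comment> \<open>The exponents start at one: that \<open>?P\<close> itself lies almost in
    \<open>A\<close> is what has to be shown.\<close>
  have image: "ae_subset M ((That ^^ Suc n) ?P) A" for n
  proof (induction n)
    case 0
    show ?case
      using That_ae_subset_iff[OF P A] ae_subset_refl by simp
  next
    case (Suc n)
    have "ae_subset M (That ((That ^^ Suc n) ?P)) (That A)"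
      by (rule That_mono[OF sets_funpow_That[OF P] A Suc])
    then have "ae_subset M (That ((That ^^ Suc n) ?P)) A"
      using ae_subset_trans[OF sets_That[OF sets_funpow_That[OF P]] sets_That[OF A] A _ inv] by blast
    then show ?case by simp
  qed
  have "ae_subset M (\<Union>n\<in>{1..}. (That ^^ n) ?P) A"
  proof (rule ae_subset_UN)
    fix n :: nat assume "n \<in> {1..}"
    then show "ae_subset M ((That ^^ n) ?P) A"
      using image[of "n - 1"] by simp
  qed (auto intro: sets_funpow_That P A)
  moreover have "ae_subset M ?P (\<Union>n\<in>{1..}. (That ^^ n) ?P)"
    using cons P by (simp add: conservative_iff_ae_subset_UN)
  ultimately have "ae_subset M ?P A"
    using ae_subset_trans[OF P sets_UN_funpow_That[OF P] A] by blast
  then show ?thesis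
    by (simp add: That_compl_ae_subset_iff A)
qed

text \<open>The union \<open>A\<close> of the proper images of a wandering set \<open>W\<close> is
  invariant, so by hypothesis it almost contains its preimage. That preimage almost contains
  \<open>W\<close>, yet \<open>W\<close> is almost disjoint from \<open>A\<close>.\<close>

lemma That_compl_imp_conservative:
  assumes compl: "\<And>A. A \<in> sets M \<Longrightarrow> ae_subset M (That A) A \<Longrightarrow>
    ae_subset M (That (space M - A)) (space M - A)"
  shows "conservative M T"
  unfolding conservative_def
proof (intro allI impI)
  fix W assume wand: "wandering M T W"
  then have W: "W \<in> sets M"
    by (simp add: wandering_def)
  define A where "A = (\<Union>n\<in>{1..}. (That ^^ n) W)"
  have A: "A \<in> sets M"
    unfolding A_def by (rule sets_UN_funpow_That[OF W])
  \<comment> \<open>The exponents \<open>n \<ge> 1\<close> give the invariance of \<open>A\<close>;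
    the exponent \<open>0\<close> places \<open>W\<close> itself in the preimage of
    \<open>A\<close>.\<close>
  have image: "ae_subset M ((That ^^ n) W) (T -` A \<inter> space M)" for n
  proof -
    have "ae_subset M ((That ^^ Suc n) W) A"
      unfolding A_def by (intro ae_subset_mono sets_funpow_That sets_UN_funpow_That W UN_upper) auto
    then show ?thesis
      by (simp add: That_ae_subset_iff sets_funpow_That W A)
  qed
  then have "ae_subset M A (T -` A \<inter> space M)"
    by (subst A_def, intro ae_subset_UN) (auto intro: sets_funpow_That W sets_vimage A)
  then have "ae_subset M (T -` A \<inter> space M) A"
    using compl[OF A] by (simp add: That_compl_ae_subset_iff That_ae_subset_iff A)
  then have "ae_subset M W A"
    using image[of 0] ae_subset_trans[OF W sets_vimage[OF A] A] by simp
  then have "emeasure M (W - A) = 0" "emeasure M (W \<inter> A) = 0"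
    using wandering_disjoint_images[OF W wand] by (simp_all add: ae_subset_def A_def)
  then have "(W - A) \<union> (W \<inter> A) \<in> null_sets M"
    using W A by (intro null_sets.Un) (auto simp: null_sets_def)
  then show "emeasure M W = 0"
    by (simp add: Un_Diff_Int null_setsD1)
qed

section \<open>Nonsingularity\<close>

text \<open>If the preimage of \<open>B\<close> is null, then so are all its iterated preimages.
  Hence \<open>B\<close> is wandering, and conservativity makes it null.\<close>

lemma conservative_imp_nonsingular:
  assumes "conservative M T"
  shows "nonsingular M T"
proof -
  have "emeasure M B = 0" if B: "B \<in> sets M" and null: "emeasure M (T -` B \<inter> space M) = 0" for B
  proof -
    have pre: "emeasure M ((T ^^ Suc n) -` B \<inter> space M) = 0" for n
    proof (induction n)
      case 0
      show ?case using null by simp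
    next
      case (Suc n)
      then show ?case
        using null_preserving sets_vimage_funpow[OF B, of "Suc n"]
        unfolding vimage_funpow_Suc[of "Suc n"] null_preserving_def by blast
    qed
    have "emeasure M (B \<inter> ((T ^^ n) -` B \<inter> space M)) = 0" if "n \<ge> 1" for n
      using pre[of "n - 1"] that
      by (intro emeasure_eq_0[OF sets_vimage_funpow[OF B, of n] _ Int_lower2]) simp
    then have "wandering M T B"
      using B by (simp add: wandering_def ae_eq_def)
    then show ?thesis
      using assms by (simp add: conservative_def)
  qed
  then have "emeasure M (T -` B \<inter> space M) = 0 \<longleftrightarrow> emeasure M B = 0" if "B \<in> sets M" for B
    using null_preserving that unfolding null_preserving_def by metis
  then have "B \<in> null_sets (distr M M T) \<longleftrightarrow> B \<in> null_sets M" for B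
    by (cases "B \<in> sets M") (simp_all add: null_sets_def emeasure_distr measurable_T)
  \<comment> \<open>Equality of the null sets is absolute continuity in both directions.\<close>
  then have "null_sets (distr M M T) = null_sets M"
    by (intro set_eqI)
  then show ?thesis
    by (simp add: nonsingular_def absolutely_continuous_def)
qed

end

theorem theorem4p5:
  fixes M :: "'a measure" and T :: "'a \<Rightarrow> 'a" and That :: "'a set \<Rightarrow> 'a set"
  assumes "sigma_finite_measure M"
    and "null_preserving M T"
    and "essential_image_map M T That"
  shows "(conservative M T \<longleftrightarrow>
            (\<forall>A\<in>sets M. ae_subset M A (\<Union>n\<in>{1..}. (That ^^ n) A)))
       \<and> (conservative M T \<longleftrightarrow>
            (\<forall>A\<in>sets M. ae_subset M A (\<Inter>m\<in>{1..}. \<Union>n\<in>{m..}. (That ^^ n) A)))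
       \<and> (conservative M T \<longleftrightarrow>
            (\<forall>A\<in>sets M. ae_subset M (That A) A \<longrightarrow>
               ae_subset M (That (space M - A)) (space M - A)))
       \<and> (conservative M T \<longrightarrow> nonsingular M T)"
proof -
  interpret essential_image_system M T That
    using assms(2,3) by unfold_locales
  show ?thesis
    using conservative_iff_ae_subset_UN conservative_iff_ae_subset_limsup
      conservative_imp_That_compl That_compl_imp_conservative conservative_imp_nonsingular
    by blast
qed

end
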